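(* Let $p$ be a prime and let $G$ be a finite nonabelian $p$-group. Then $\epsilon_\infty=1$ if and only if $G$ is a nested GVZ-group. In this event, if $G=X_0>X_1>\dotsb>X_n>1$ is the chain of centers for $G$, then $\epsilon_{i+1}=X_i$ for each $0\le i\le n$, and $\epsilon_{n+2}=1$.
   Context: All groups are finite and characters are complex; $\mathrm{Irr}(G)$ is the set of irreducible characters of $G$. For a normal subgroup $N\lhd G$, let $\mathrm{Irr}(G\mid N)=\{\chi\in\mathrm{Irr}(G): N\nleq\ker(\chi)\}$, and let $V(G\mid N)$ be the subgroup of $G$ generated by all $g\in G$ such that $\chi(g)\neq 0$ for some $\chi\in\mathrm{Irr}(G\mid N)$; in particular $V(G\mid 1)=1$. Define a descending chain $G=\epsilon_1\ge\epsilon_2\ge\dotsb$ of normal subgroups of $G$ by $\epsilon_1=G$ and $\epsilon_{i+1}=V(G\mid[\epsilon_i,G])$ for $i\ge 1$; $\epsilon_\infty$ denotes the terminal member (eventual constant value) of this chain. For $\chi\in\mathrm{Irr}(G)$, $Z(\chi)=\{g\in G:|\chi(g)|=\chi(1)\}$ is the center of $\chi$, and $V(\chi)$ is the subgroup generated by all $g\in G$ with $\chi(g)\ne 0$. $G$ is a GVZ-group if $V(\chi)=Z(\chi)$ for all $\chi\in\mathrm{Irr}(G)$ (i.e. every $\chi\in\mathrm{Irr}(G)$ vanishes on $G\setminus Z(\chi)$). $G$ is nested if the set $\{Z(\chi):\chi\in\mathrm{Irr}(G)\}$ is a chain under inclusion; in that case this set, listed as $G=X_0>X_1>\dotsb>X_n$,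 is called the chain of centers for $G$. A nested GVZ-group is a group that is both nested and a GVZ-group. *)

theory Defs
  imports
    Complex_Main
    "HOL-Computational_Algebra.Primes"
    "HOL-Algebra.Generated_Groups"
    "Jordan_Normal_Form.VS_Connect"
begin

abbreviation GL :: "nat \<Rightarrow> complex mat monoid" where
  "GL n \<equiv> units_of (ring_mat TYPE(complex) n ())"

definition irreducible_rep :: "('a, 'b) monoid_scheme \<Rightarrow> nat \<Rightarrow> ('a \<Rightarrow> complex mat) \<Rightarrow> bool" where
  "irreducible_rep G n \<rho> \<longleftrightarrow>
     n > 0 \<and> \<rho> \<in> hom G (GL n) \<and>
     (\<forall>W. VectorSpace.subspace class_ring W (module_vec TYPE(complex) n) \<and>
          (\<forall>g\<in>carrier G. \<forall>w\<in>W. \<rho> g *\<^sub>v w \<in> W)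
          \<longrightarrow> W = {0\<^sub>v n} \<or> W = carrier_vec n)"

text \<open>Characters are restricted to the carrier so that equal characters are equal functions.\<close>

definition rep_character :: "('a, 'b) monoid_scheme \<Rightarrow> nat \<Rightarrow> ('a \<Rightarrow> complex mat) \<Rightarrow> 'a \<Rightarrow> complex" where
  "rep_character G n \<rho> = (\<lambda>g\<in>carrier G. \<Sum>i<n. \<rho> g $$ (i, i))"

definition Irr :: "('a, 'b) monoid_scheme \<Rightarrow> ('a \<Rightarrow> complex) set" where
  "Irr G = {rep_character G n \<rho> | n \<rho>. irreducible_rep G n \<rho>}"

definition char_kernel :: "('a, 'b) monoid_scheme \<Rightarrow> ('a \<Rightarrow> complex) \<Rightarrow> 'a set" where
  "char_kernel G \<chi> = {g \<in> carrier G. \<chi> g = \<chi> \<one>\<^bsub>G\<^esub>}"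

definition char_center :: "('a, 'b) monoid_scheme \<Rightarrow> ('a \<Rightarrow> complex) \<Rightarrow> 'a set" where
  "char_center G \<chi> = {g \<in> carrier G. of_real (cmod (\<chi> g)) = \<chi> \<one>\<^bsub>G\<^esub>}"

definition char_V :: "('a, 'b) monoid_scheme \<Rightarrow> ('a \<Rightarrow> complex) \<Rightarrow> 'a set" where
  "char_V G \<chi> = generate G {g \<in> carrier G. \<chi> g \<noteq> 0}"

definition Irr_over :: "('a, 'b) monoid_scheme \<Rightarrow> 'a set \<Rightarrow> ('a \<Rightarrow> complex) set" where
  "Irr_over G N = {\<chi> \<in> Irr G. \<not> N \<subseteq> char_kernel G \<chi>}"

definition V_over :: "('a, 'b) monoid_scheme \<Rightarrow> 'a set \<Rightarrow> 'a set" where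
  "V_over G N = generate G {g \<in> carrier G. \<exists>\<chi>\<in>Irr_over G N. \<chi> g \<noteq> 0}"

definition commutator_subgroup :: "('a, 'b) monoid_scheme \<Rightarrow> 'a set \<Rightarrow> 'a set \<Rightarrow> 'a set" where
  "commutator_subgroup G H K =
     generate G {inv\<^bsub>G\<^esub> h \<otimes>\<^bsub>G\<^esub> inv\<^bsub>G\<^esub> k \<otimes>\<^bsub>G\<^esub> h \<otimes>\<^bsub>G\<^esub> k | h k. h \<in> H \<and> k \<in> K}"

text \<open>The chain is indexed from 1; the value at 0 is a dummy.\<close>

fun eps :: "('a, 'b) monoid_scheme \<Rightarrow> nat \<Rightarrow> 'a set" where
  "eps G 0 = carrier G"
| "eps G (Suc 0) = carrier G"
| "eps G (Suc (Suc i)) = V_over G (commutator_subgroup G (eps G (Suc i)) (carrier G))"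

definition eps_inf :: "('a, 'b) monoid_scheme \<Rightarrow> 'a set" where
  "eps_inf G = (THE H. \<forall>\<^sub>F i in sequentially. eps G i = H)"

definition GVZ_group :: "('a, 'b) monoid_scheme \<Rightarrow> bool" where
  "GVZ_group G \<longleftrightarrow> (\<forall>\<chi>\<in>Irr G. char_V G \<chi> = char_center G \<chi>)"

definition nested_group :: "('a, 'b) monoid_scheme \<Rightarrow> bool" where
  "nested_group G \<longleftrightarrow> chain_subset (char_center G ` Irr G)"

definition chain_of_centers :: "('a, 'b) monoid_scheme \<Rightarrow> nat \<Rightarrow> (nat \<Rightarrow> 'a set) \<Rightarrow> bool" where
  "chain_of_centers G n X \<longleftrightarrow>
     X 0 = carrier G \<and> (\<forall>i<n. X (Suc i) \<subset> X i) \<and> X ` {..n} = char_center G ` Irr G"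

lemma (in group) V_over_mono:
  assumes "N \<subseteq> M" shows "V_over G N \<subseteq> V_over G M"
  unfolding V_over_def Irr_over_def using assms by (intro mono_generate) blast

lemma (in group) V_over_subset: "V_over G N \<subseteq> carrier G"
  unfolding V_over_def by (intro generate_incl) blast

lemma (in group) commutator_subgroup_mono:
  assumes "H \<subseteq> H'" shows "commutator_subgroup G H K \<subseteq> commutator_subgroup G H' K"
  unfolding commutator_subgroup_def using assms by (intro mono_generate) blast

lemma (in group) eps_Suc_subset: "eps G (Suc i) \<subseteq> eps G i"
proof (induction i rule: less_induct)
  case (less i)
  consider "i = 0" | "i = 1" | j where "i = Suc (Suc j)"
    by (metis One_nat_def not0_implies_Suc)
  then show ?case
  proof cases
    case 3
    then have "eps G (Suc (Suc j)) \<subseteq> eps G (Suc j)"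
      using less[of "Suc j"] by blast
    then show ?thesis
      unfolding 3 eps.simps(3)[of G "Suc j"] eps.simps(3)[of G j]
      by (intro V_over_mono commutator_subgroup_mono)
  qed (simp_all add: V_over_subset)
qed

lemma (in group) eventually_eps_eq_eps_inf:
  assumes fin: "finite (carrier G)"
  shows "\<forall>\<^sub>F i in sequentially. eps G i = eps_inf G"
proof -
  have mono: "eps G j \<subseteq> eps G i" if "i \<le> j" for i j
    using that by (rule lift_Suc_antimono_le[of "eps G", OF eps_Suc_subset])
  have sub: "eps G i \<subseteq> carrier G" for i using mono[of 0 i] by simp
  obtain m where m: "\<And>i. card (eps G m) \<le> card (eps G i)"
    using ex_has_least_nat[of "\<lambda>_. True" 0 "\<lambda>i. card (eps G i)"] by auto
  have "eps G i = eps G m" if "m \<le> i" for i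
    using card_seteq[OF finite_subset[OF sub fin] mono[OF that] m] .
  then have ev: "\<forall>\<^sub>F i in sequentially. eps G i = eps G m"
    unfolding eventually_sequentially by blast
  show ?thesis unfolding eps_inf_def
  proof (rule theI[of _ "eps G m"], rule ev)
    fix H assume "\<forall>\<^sub>F i in sequentially. eps G i = H"
    then have "\<forall>\<^sub>F i in sequentially. H = eps G m"
      using ev by (rule eventually_elim2) (rule trans[OF sym])
    then show "H = eps G m" by (simp only: eventually_const[OF sequentially_bot])
  qed
qed

end

theory Submission
  imports
    Defs
    "HOL-Algebra.Multiplicative_Group"
    "Jordan_Normal_Form.Schur_Decomposition"
    "Jordan_Normal_Form.Spectral_Radius"
begin

text \<open>
  Everything rests on one equivalence: for an irreducible character \<open>\<chi>\<close> and \<open>X \<subseteq> G\<close>,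
  the subgroup \<open>[X, G]\<close> lies in \<open>ker \<chi>\<close> exactly when \<open>X \<subseteq> Z(\<chi>)\<close>
  (\<open>commutator_subgroup_kernel_iff\<close>).  Indeed \<open>[X, G] \<subseteq> ker \<chi>\<close> says that the matrices of
  the elements of \<open>X\<close> commute with the whole representation, by Schur's lemma this says that they
  are scalar, and \<open>Z(\<chi>)\<close> is the set of elements represented by scalar matrices.  This last
  fact needs that a matrix of finite order whose trace has modulus equal to its size is scalar
  (\<open>finite_order_trace_norm_imp_scalar\<close>).  The equivalence turns the recursion
  into \<open>\<epsilon>\<^sub>i\<^sub>+\<^sub>1 = \<langle>g | \<chi>(g) \<noteq> 0 for some \<chi> with \<epsilon>\<^sub>i not contained in Z(\<chi>)\<rangle>\<close>.

  Suppose that some \<open>\<epsilon>\<^sub>m\<close> is trivial.  Given \<open>\<chi>\<close>, let \<open>\<epsilon>\<^sub>i\<close> be the first member inside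
  \<open>Z(\<chi>)\<close>.  If it is not \<open>G\<close>, its predecessor is not inside \<open>Z(\<chi>)\<close>; in either case all \<open>g\<close>
  with \<open>\<chi>(g) \<noteq> 0\<close> lie in \<open>\<epsilon>\<^sub>i\<close>.  As \<open>\<chi>\<close> is nonzero on \<open>Z(\<chi>)\<close>, the support of \<open>\<chi>\<close>, \<open>\<epsilon>\<^sub>i\<close> and \<open>Z(\<chi>)\<close>
  coincide.  Hence \<open>G\<close> is a GVZ-group, and its centers are members of a chain.

  Conversely, in a GVZ-group the support of \<open>\<chi>\<close> is \<open>Z(\<chi>)\<close>, so \<open>\<epsilon>\<^sub>i\<^sub>+\<^sub>1\<close> is generated by the
  centers not containing \<open>\<epsilon>\<^sub>i\<close>.  When the centers form a chain and \<open>\<epsilon>\<^sub>i\<close> is one of them, the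
  generated subgroup is the largest center properly inside \<open>\<epsilon>\<^sub>i\<close>, or trivial when there is none
  (\<open>V_over_commutator_nested_GVZ\<close>): the sequence \<open>\<epsilon>\<close> walks down the chain of centers and
  then drops to the trivial group.  The last center is itself nontrivial, because an irreducible
  character supported on the identity forces the group to be trivial
  (\<open>trivial_if_vanishes_off_one\<close>).
\<close>

section \<open>Matrices of finite order with trace of maximal modulus\<close>

lemma upper_triangular_mult:
  fixes A B :: "'a :: semiring_1 mat"
  assumes A: "A \<in> carrier_mat n n" "upper_triangular A"
    and B: "B \<in> carrier_mat n n" "upper_triangular B"
  shows "upper_triangular (A * B)"
    and "i < n \<Longrightarrow> (A * B) $$ (i, i) = A $$ (i, i) * B $$ (i, i)"
proof -
  have entry: "(A * B) $$ (i, j) = (\<Sum>l\<in>{0..<n}. A $$ (i, l) * B $$ (l, j))"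
    if "i < n" "j < n" for i j
    using A(1) B(1) that by (simp add: scalar_prod_def)
  have vanish: "A $$ (i, l) * B $$ (l, j) = 0" if "i < n" "l < n" "l < i \<or> j < l" for i j l
    using upper_triangularD[OF A(2), of l i] upper_triangularD[OF B(2), of j l] that A(1) B(1)
    by auto
  show "upper_triangular (A * B)"
  proof
    fix i j assume ij: "j < i" "i < dim_row (A * B)"
    then have "i < n" "j < n" using A(1) by auto
    with ij(1) show "(A * B) $$ (i, j) = 0"
      by (subst entry) (auto intro!: sum.neutral vanish)
  qed
  show "(A * B) $$ (i, i) = A $$ (i, i) * B $$ (i, i)" if "i < n"
  proof -
    have "(\<Sum>l\<in>{0..<n}. A $$ (i, l) * B $$ (l, i)) = (\<Sum>l\<in>{i}. A $$ (i, l) * B $$ (l, i))"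
      using that by (intro sum.mono_neutral_right) (auto intro!: vanish)
    then show ?thesis using that by (simp only: entry) simp
  qed
qed

lemma upper_triangular_pow:
  fixes A :: "'a :: comm_semiring_1 mat"
  assumes "A \<in> carrier_mat n n" "upper_triangular A"
  shows "upper_triangular (A ^\<^sub>m k)"
    and "i < n \<Longrightarrow> (A ^\<^sub>m k) $$ (i, i) = A $$ (i, i) ^ k"
proof -
  have *: "upper_triangular (A ^\<^sub>m k) \<and> (\<forall>i<n. (A ^\<^sub>m k) $$ (i, i) = A $$ (i, i) ^ k)"
  proof (induction k)
    case 0
    show ?case using assms(1) by simp
  next
    case (Suc k)
    have "A ^\<^sub>m k \<in> carrier_mat n n" using assms(1) by simp
    from upper_triangular_mult[OF this _ assms] Suc show ?case by (simp add: mult.commute)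
  qed
  show "upper_triangular (A ^\<^sub>m k)" using * by blast
  show "i < n \<Longrightarrow> (A ^\<^sub>m k) $$ (i, i) = A $$ (i, i) ^ k" using * by blast
qed

lemma mat_eq_if_eq_on_vecs:
  fixes A B :: "'a :: comm_semiring_1 mat"
  assumes A: "A \<in> carrier_mat n n" and B: "B \<in> carrier_mat n n"
    and eq: "\<And>v. v \<in> carrier_vec n \<Longrightarrow> A *\<^sub>v v = B *\<^sub>v v"
  shows "A = B"
proof (rule eq_matI)
  fix i j assume "i < dim_row B" "j < dim_col B"
  then have ij: "i < n" "j < n" using B by auto
  have "(A *\<^sub>v unit_vec n j) $ i = (B *\<^sub>v unit_vec n j) $ i" by (simp add: eq)
  then show "A $$ (i, j) = B $$ (i, j)"
    using A B ij by (simp add: scalar_prod_right_unit)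
qed (use A B in auto)

lemma scalar_mat_mult_vec:
  fixes v :: "'a :: comm_semiring_1 vec"
  assumes "v \<in> carrier_vec n"
  shows "(c \<cdot>\<^sub>m 1\<^sub>m n) *\<^sub>v v = c \<cdot>\<^sub>v v"
  using assms by (intro eq_vecI) auto

lemma mat_mult_eq_zeroD:
  fixes S M :: "'a :: field mat"
  assumes S: "S \<in> carrier_mat n n" and M: "M \<in> carrier_mat n n"
    and det: "det S \<noteq> 0" and prod: "S * M = 0\<^sub>m n n"
  shows "M = 0\<^sub>m n n"
proof (rule mat_eq_if_eq_on_vecs[OF M zero_carrier_mat])
  fix v :: "'a vec" assume v: "v \<in> carrier_vec n"
  have zero: "0\<^sub>m n n *\<^sub>v v = 0\<^sub>v n" using v by (intro eq_vecI) auto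
  have "S *\<^sub>v (M *\<^sub>v v) = 0\<^sub>v n"
    using assoc_mult_mat_vec[OF S M v] prod zero by simp
  then have "M *\<^sub>v v = 0\<^sub>v n"
    using det_0_iff_vec_prod_zero_field[OF S] det mult_mat_vec_carrier[OF M v] by blast
  then show "M *\<^sub>v v = 0\<^sub>m n n *\<^sub>v v" using zero by simp
qed

text \<open>A nontrivial unipotent matrix over a field of characteristic \<open>0\<close> has infinite order.
  With \<open>S = (\<Sum>j<k. c^(k-1-j) B^j)\<close> the geometric sum telescopes,
  \<open>S (B - c) = B^k - c^k = 0\<close>, while \<open>S\<close> is upper triangular with all diagonal entries
  \<open>k c^(k-1) \<noteq> 0\<close>, hence nonsingular.\<close>

lemma upper_triangular_finite_order_scalar:
  fixes B :: "complex mat"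
  assumes B: "B \<in> carrier_mat n n" "upper_triangular B"
    and k: "k > 0" "B ^\<^sub>m k = 1\<^sub>m n"
    and c: "c ^ k = 1" "\<And>i. i < n \<Longrightarrow> B $$ (i, i) = c"
  shows "B = c \<cdot>\<^sub>m 1\<^sub>m n"
proof -
  \<comment> \<open>The geometric sums \<open>S j = (\<Sum>l<j. c ^ l B ^ (j - 1 - l))\<close>, defined by recursion so that
     their properties follow by induction.\<close>
  define S where "S = rec_nat (0\<^sub>m n n) (\<lambda>j T. c ^ j \<cdot>\<^sub>m 1\<^sub>m n + T * B)"
  have S0: "S 0 = 0\<^sub>m n n" and SS: "\<And>j. S (Suc j) = c ^ j \<cdot>\<^sub>m 1\<^sub>m n + S j * B"
    by (simp_all add: S_def)
  let ?N = "B - c \<cdot>\<^sub>m 1\<^sub>m n"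
  have Sc: "S j \<in> carrier_mat n n" for j using B(1) by (induction j) (simp_all add: S0 SS)
  have N: "?N \<in> carrier_mat n n" by (intro minus_carrier_mat) simp
  have comm: "B * ?N = ?N * B"
    using B(1) by (simp add: mult_minus_distrib_mat[of _ n n _ n] minus_mult_distrib_mat[of _ n n _ _ n]
        mult_smult_distrib[of _ n n _ n] mult_smult_assoc_mat[of _ n n _ n])
  have Bj: "B ^\<^sub>m j \<in> carrier_mat n n" for j using B(1) by simp
  have tele: "S j * ?N = B ^\<^sub>m j - c ^ j \<cdot>\<^sub>m 1\<^sub>m n" for j
  proof (induction j)
    case 0
    have "1\<^sub>m n - 1 \<cdot>\<^sub>m 1\<^sub>m n = (0\<^sub>m n n :: complex mat)" by (intro eq_matI) auto
    then show ?case using B(1) N by (simp add: S0)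
  next
    case (Suc j)
    have "S (Suc j) * ?N = c ^ j \<cdot>\<^sub>m ?N + S j * B * ?N"
      unfolding SS using N Sc[of j] B(1)
      by (subst add_mult_distrib_mat[of _ n n _ _ n]) (auto simp: mult_smult_assoc_mat[of _ n n _ n])
    also have "S j * B * ?N = S j * ?N * B"
      using Sc[of j] B(1) N comm by (simp add: assoc_mult_mat[of _ n n _ n _ n])
    also have "\<dots> = B ^\<^sub>m Suc j - c ^ j \<cdot>\<^sub>m B"
      unfolding Suc using B(1) Bj[of j]
      by (subst minus_mult_distrib_mat[of _ n n _ _ n]) (auto simp: mult_smult_assoc_mat[of _ n n _ n])
    finally show ?case
      using B(1) Bj[of "Suc j"] by (intro eq_matI) (auto simp: algebra_simps)
  qed
  \<comment> \<open>The factor \<open>c\<close> on the left avoids the exponent \<open>j - 1\<close>, which truncates at \<open>j = 0\<close>.\<close>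
  have diag: "upper_triangular (S j) \<and> (\<forall>i<n. c * S j $$ (i, i) = of_nat j * c ^ j)" for j
  proof (induction j)
    case 0
    show ?case by (simp add: S0)
  next
    case (Suc j)
    then have ut: "upper_triangular (S j)" by blast
    note m = upper_triangular_mult[OF Sc ut B]
    have "upper_triangular (S (Suc j))"
      using m(1) B(1) Sc[of j] by (auto simp: SS upper_triangular_def)
    moreover have "c * S (Suc j) $$ (i, i) = of_nat (Suc j) * c ^ Suc j" if "i < n" for i
    proof -
      have "S (Suc j) $$ (i, i) = c ^ j + S j $$ (i, i) * c"
        using that B(1) Sc[of j] m(2)[OF that] c(2)[OF that] by (simp add: SS)
      moreover have "c * S j $$ (i, i) = of_nat j * c ^ j" using Suc that by blast
      ultimately show ?thesis by (simp add: algebra_simps)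
    qed
    ultimately show ?case by blast
  qed
  have "S k $$ (i, i) \<noteq> 0" if "i < n" for i
  proof -
    have "c * S k $$ (i, i) = of_nat k" using diag[of k] that c(1) by simp
    then show ?thesis using k(1) by auto
  qed
  then have "det (S k) \<noteq> 0"
    using diag[of k] Sc[of k] by (auto simp: upper_triangular_imp_det_eq_0_iff diag_mat_def)
  moreover have "S k * ?N = 0\<^sub>m n n" unfolding tele k(2) c(1) by auto
  ultimately have "?N = 0\<^sub>m n n" by (rule mat_mult_eq_zeroD[OF Sc N])
  then have "?N + c \<cdot>\<^sub>m 1\<^sub>m n = c \<cdot>\<^sub>m 1\<^sub>m n" by simp
  then show ?thesis using B(1) by (auto simp: mat_eq_iff)
qed

lemma trace_mult_commute:
  fixes A B :: "'a :: comm_semiring_1 mat"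
  assumes "A \<in> carrier_mat n n" "B \<in> carrier_mat n n"
  shows "(\<Sum>i<n. (A * B) $$ (i, i)) = (\<Sum>i<n. (B * A) $$ (i, i))"
proof -
  have "(\<Sum>i<n. (A * B) $$ (i, i)) = (\<Sum>i<n. \<Sum>j<n. A $$ (i, j) * B $$ (j, i))"
    using assms by (auto simp: scalar_prod_def atLeast0LessThan intro!: sum.cong)
  also have "\<dots> = (\<Sum>j<n. \<Sum>i<n. B $$ (j, i) * A $$ (i, j))"
    by (subst sum.swap) (simp add: mult.commute)
  also have "\<dots> = (\<Sum>i<n. (B * A) $$ (i, i))"
    using assms by (auto simp: scalar_prod_def atLeast0LessThan intro!: sum.cong)
  finally show ?thesis .
qed

text \<open>The equality case of the triangle inequality: if \<open>u\<close> is the mean of the numbers \<open>b i\<close>,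
  then the real parts of \<open>cnj u * b i\<close> are at most \<open>1\<close> and average to \<open>1\<close>.\<close>

lemma unit_numbers_eq_if_norm_sum_eq:
  fixes b :: "nat \<Rightarrow> complex"
  assumes b: "\<And>i. i < n \<Longrightarrow> cmod (b i) = 1" and sum: "cmod (\<Sum>i<n. b i) = real n"
    and ij: "i < n" "j < n"
  shows "b i = b j"
proof -
  define u where "u = (\<Sum>i<n. b i) / of_nat n"
  have n: "n > 0" using ij by simp
  have u: "cmod u = 1" using sum n by (simp add: u_def norm_divide)
  have le: "Re (cnj u * b l) \<le> 1" if "l < n" for l
    using complex_Re_le_cmod[of "cnj u * b l"] b[OF that] u by (simp add: norm_mult)
  have "(\<Sum>l<n. cnj u * b l) = cnj u * (of_nat n * u)"
    unfolding sum_distrib_left[symmetric] using n by (simp add: u_def)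
  also have "\<dots> = of_nat n * (u * cnj u)" by (simp add: mult_ac)
  also have "\<dots> = of_nat n" using u by (simp flip: complex_norm_square)
  finally have "(\<Sum>l<n. Re (cnj u * b l)) = real n"
    by (simp only: Re_sum[symmetric]) simp
  then have "(\<Sum>l<n. 1 - Re (cnj u * b l)) = 0"
    by (simp only: sum_subtractf) simp
  then have "\<forall>l\<in>{..<n}. 1 - Re (cnj u * b l) = 0"
    by (subst (asm) sum_nonneg_eq_0_iff) (use le in auto)
  then have re: "Re (cnj u * b l) = 1" if "l < n" for l using that by simp
  have "cnj u * b l = 1" if "l < n" for l
  proof -
    have "cmod (cnj u * b l) = 1" using b[OF that] u by (simp add: norm_mult)
    then have "Im (cnj u * b l) = 0"
      using cmod_power2[of "cnj u * b l"] unfolding re[OF that] by simp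
    with re[OF that] show ?thesis by (simp only: complex_eq_iff one_complex.sel)
  qed
  with ij have "cnj u * b i = cnj u * b j" by simp
  then show ?thesis using u by auto
qed

lemma norm_root_of_unity:
  fixes c :: complex
  assumes "k > 0" "c ^ k = 1"
  shows "cmod c = 1"
proof (rule power_eq_imp_eq_base)
  show "cmod c ^ k = 1 ^ k" using assms(2) by (simp flip: norm_power)
qed (use assms(1) in auto)

text \<open>The eigenvalues are roots of unity whose sum, the trace, has the largest possible modulus, so
  they all coincide.  A triangular form of the matrix is then scalar by
  \<open>upper_triangular_finite_order_scalar\<close>, and a scalar matrix is its only conjugate.\<close>

lemma finite_order_trace_norm_imp_scalar:
  fixes A :: "complex mat"
  assumes A: "A \<in> carrier_mat n n" and n: "n > 0" and k: "k > 0" "A ^\<^sub>m k = 1\<^sub>m n"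
    and tr: "cmod (\<Sum>i<n. A $$ (i, i)) = real n"
  shows "\<exists>c. A = c \<cdot>\<^sub>m 1\<^sub>m n"
proof -
  obtain B where B: "B \<in> carrier_mat n n" "upper_triangular B" and sim: "similar_mat A B"
    using char_poly_factorized[OF A] schur_decomposition_exists[OF A] by blast
  then obtain P Q where wit: "similar_mat_wit A B P Q" by (auto simp: similar_mat_def)
  note w = similar_mat_witD2[OF A wit]
  have Bk: "B ^\<^sub>m k = 1\<^sub>m n"
    using similar_mat_wit_pow_id[OF similar_mat_wit_sym[OF wit], of k] k(2) w by simp
  have root: "B $$ (i, i) ^ k = 1" if "i < n" for i
    using upper_triangular_pow(2)[OF B that, of k] that by (simp add: Bk)
  have unit: "cmod (B $$ (i, i)) = 1" if "i < n" for i
    using norm_root_of_unity[OF k(1) root[OF that]] .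
  have "(\<Sum>i<n. A $$ (i, i)) = (\<Sum>i<n. (Q * (P * B)) $$ (i, i))"
    unfolding w(3) using w by (intro trace_mult_commute) auto
  also have "Q * (P * B) = B" using w(2,5,6,7) by (subst assoc_mult_mat[symmetric, of _ n n _ n _ n]) auto
  finally have "cmod (\<Sum>i<n. B $$ (i, i)) = real n" using tr by simp
  then have "B $$ (i, i) = B $$ (0, 0)" if "i < n" for i
    using unit_numbers_eq_if_norm_sum_eq[of n "\<lambda>i. B $$ (i, i)" i 0] unit n that by blast
  then have "B = B $$ (0, 0) \<cdot>\<^sub>m 1\<^sub>m n"
    using upper_triangular_finite_order_scalar[OF B k(1) Bk] root[OF n] by blast
  then obtain c where c: "B = c \<cdot>\<^sub>m 1\<^sub>m n" by blast
  have "A = P * (c \<cdot>\<^sub>m 1\<^sub>m n) * Q" using w(3) c by simp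
  also have "\<dots> = c \<cdot>\<^sub>m (P * Q)"
    using w(6,7) by (simp add: mult_smult_assoc_mat[of _ n n _ n] mult_smult_distrib[of _ n n _ n])
  finally show ?thesis using w(1) by auto
qed

section \<open>Irreducible matrix representations of finite groups\<close>

locale finite_irrep = group G for G (structure) +
  fixes n :: nat and \<rho> :: "'a \<Rightarrow> complex mat"
  assumes finite_carrier: "finite (carrier G)"
    and irrep: "irreducible_rep G n \<rho>"
begin

abbreviation \<chi> :: "'a \<Rightarrow> complex" where "\<chi> \<equiv> rep_character G n \<rho>"

lemma degree_pos: "n > 0"
  using irrep by (simp add: irreducible_rep_def)

lemma rep_hom: "\<rho> \<in> hom G (GL n)"
  using irrep by (simp add: irreducible_rep_def)

lemma rep_closed [simp]: "g \<in> carrier G \<Longrightarrow> \<rho> g \<in> carrier_mat n n"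
  using rep_hom by (auto simp: hom_def units_of_def Units_def ring_mat_simps)

lemma rep_mult: "g \<in> carrier G \<Longrightarrow> h \<in> carrier G \<Longrightarrow> \<rho> (g \<otimes> h) = \<rho> g * \<rho> h"
  using rep_hom by (auto simp: hom_def units_of_def ring_mat_simps)

lemma rep_one: "\<rho> \<one> = 1\<^sub>m n"
proof -
  interpret R: ring "ring_mat TYPE(complex) n ()" by (rule ring_mat)
  have "group (GL n)" by (rule R.units_group)
  from hom_one[OF rep_hom is_group this] show ?thesis
    by (simp add: units_of_def ring_mat_simps)
qed

lemma rep_pow: "g \<in> carrier G \<Longrightarrow> \<rho> (g [^] (k::nat)) = \<rho> g ^\<^sub>m k"
  by (induction k) (auto simp: rep_one rep_mult dest: rep_closed)

lemma rep_finite_order: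
  assumes "g \<in> carrier G"
  shows "Coset.order G > 0" and "\<rho> g ^\<^sub>m Coset.order G = 1\<^sub>m n"
proof -
  show "Coset.order G > 0" using finite_carrier by (simp add: order_gt_0_iff_finite)
  have "\<rho> g ^\<^sub>m Coset.order G = \<rho> (g [^] Coset.order G)"
    using assms by (simp only: rep_pow)
  then show "\<rho> g ^\<^sub>m Coset.order G = 1\<^sub>m n"
    using pow_order_eq_1[OF assms] rep_one by simp
qed

lemma character_eq: "g \<in> carrier G \<Longrightarrow> \<chi> g = (\<Sum>i<n. \<rho> g $$ (i, i))"
  by (simp add: rep_character_def)

lemma character_scalar:
  assumes "g \<in> carrier G" "\<rho> g = c \<cdot>\<^sub>m 1\<^sub>m n"
  shows "\<chi> g = of_nat n * c"
  using assms by (simp add: character_eq)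

lemma character_one: "\<chi> \<one> = of_nat n"
  by (simp add: character_eq rep_one)

lemma invariant_subspace_trivial:
  assumes W: "W \<subseteq> carrier_vec n" "0\<^sub>v n \<in> W"
    and add: "\<And>v w. v \<in> W \<Longrightarrow> w \<in> W \<Longrightarrow> v + w \<in> W"
    and smult: "\<And>c v. v \<in> W \<Longrightarrow> c \<cdot>\<^sub>v v \<in> W"
    and inv: "\<And>g w. g \<in> carrier G \<Longrightarrow> w \<in> W \<Longrightarrow> \<rho> g *\<^sub>v w \<in> W"
  shows "W = {0\<^sub>v n} \<or> W = carrier_vec n"
proof -
  have "submodule class_ring W (module_vec TYPE(complex) n)"
    by (rule submodule.intro) (use vec_module assms in \<open>auto simp: module_vec_simps\<close>)
  then have "VectorSpace.subspace class_ring W (module_vec TYPE(complex) n)"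
    by (intro subspace.intro vec_vs)
  with inv irrep show ?thesis by (auto simp: irreducible_rep_def)
qed

text \<open>The matrix has an eigenvalue because the field is algebraically closed, and the corresponding
  eigenspace is an invariant subspace.\<close>

lemma schur:
  assumes A: "A \<in> carrier_mat n n"
    and comm: "\<And>g. g \<in> carrier G \<Longrightarrow> A * \<rho> g = \<rho> g * A"
  shows "\<exists>c. A = c \<cdot>\<^sub>m 1\<^sub>m n"
proof -
  obtain c v where v: "v \<in> carrier_vec n" "v \<noteq> 0\<^sub>v n" "A *\<^sub>v v = c \<cdot>\<^sub>v v"
    using spectrum_non_empty[OF A degree_pos] A
    by (auto simp: spectrum_def eigenvalue_def eigenvector_def)
  define W where "W = {w \<in> carrier_vec n. A *\<^sub>v w = c \<cdot>\<^sub>v w}"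
  have "W = {0\<^sub>v n} \<or> W = carrier_vec n"
  proof (rule invariant_subspace_trivial)
    fix g w assume g: "g \<in> carrier G" and w: "w \<in> W"
    have "A *\<^sub>v (\<rho> g *\<^sub>v w) = \<rho> g *\<^sub>v (A *\<^sub>v w)"
      using A rep_closed[OF g] w comm[OF g]
      by (subst (1 2) assoc_mult_mat_vec[symmetric, of _ n n _ n]) (auto simp: W_def)
    also have "\<dots> = c \<cdot>\<^sub>v (\<rho> g *\<^sub>v w)"
      using w rep_closed[OF g] by (simp add: W_def mult_mat_vec[of _ n n])
    finally show "\<rho> g *\<^sub>v w \<in> W"
      using rep_closed[OF g] w by (auto simp: W_def)
  qed (use A in \<open>auto simp: W_def mult_add_distrib_mat_vec[of _ n n] smult_add_distrib_vec[of _ n]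
         mult_mat_vec[of _ n n] smult_smult_assoc mult.commute\<close>)
  with v have "W = carrier_vec n" by (auto simp: W_def)
  then have "A *\<^sub>v v = (c \<cdot>\<^sub>m 1\<^sub>m n) *\<^sub>v v" if "v \<in> carrier_vec n" for v
    using that by (auto simp: W_def scalar_mat_mult_vec)
  then have "A = c \<cdot>\<^sub>m 1\<^sub>m n" by (intro mat_eq_if_eq_on_vecs[OF A]) auto
  then show ?thesis ..
qed

lemma scalar_norm_one:
  assumes g: "g \<in> carrier G" and c: "\<rho> g = c \<cdot>\<^sub>m 1\<^sub>m n"
  shows "cmod c = 1"
proof -
  have "(c \<cdot>\<^sub>m 1\<^sub>m n) ^\<^sub>m k = c ^ k \<cdot>\<^sub>m 1\<^sub>m n" for k
    by (induction k) (auto simp: mult_smult_distrib[of _ n n _ n] mult_smult_assoc_mat[of _ n n _ n])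
  then have "c ^ Coset.order G \<cdot>\<^sub>m 1\<^sub>m n = 1\<^sub>m n"
    using rep_finite_order(2)[OF g] c by simp
  then have "(c ^ Coset.order G \<cdot>\<^sub>m 1\<^sub>m n) $$ (0, 0) = (1\<^sub>m n :: complex mat) $$ (0, 0)" by simp
  then have "c ^ Coset.order G = 1" using degree_pos by simp
  then show ?thesis by (rule norm_root_of_unity[OF rep_finite_order(1)[OF g]])
qed

lemma scalar_iff_mem_center:
  assumes g: "g \<in> carrier G"
  shows "g \<in> char_center G \<chi> \<longleftrightarrow> (\<exists>c. \<rho> g = c \<cdot>\<^sub>m 1\<^sub>m n)"
proof
  assume "g \<in> char_center G \<chi>"
  then have "of_real (cmod (\<chi> g)) = (of_real (real n) :: complex)"
    by (simp add: char_center_def character_one)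
  then have "cmod (\<chi> g) = real n" by (simp only: of_real_eq_iff)
  then show "\<exists>c. \<rho> g = c \<cdot>\<^sub>m 1\<^sub>m n"
    using finite_order_trace_norm_imp_scalar[OF rep_closed[OF g] degree_pos rep_finite_order[OF g]] g
    by (simp add: character_eq)
next
  assume "\<exists>c. \<rho> g = c \<cdot>\<^sub>m 1\<^sub>m n"
  then obtain c where c: "\<rho> g = c \<cdot>\<^sub>m 1\<^sub>m n" ..
  show "g \<in> char_center G \<chi>"
    using g scalar_norm_one[OF g c] by (simp add: char_center_def character_scalar[OF g c] character_one norm_mult)
qed

lemma mem_kernel_iff:
  assumes g: "g \<in> carrier G"
  shows "g \<in> char_kernel G \<chi> \<longleftrightarrow> \<rho> g = 1\<^sub>m n"
proof
  assume "g \<in> char_kernel G \<chi>"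
  then have eq: "\<chi> g = of_nat n" by (simp add: char_kernel_def character_one)
  then have "g \<in> char_center G \<chi>" using g by (simp add: char_center_def character_one)
  then obtain c where c: "\<rho> g = c \<cdot>\<^sub>m 1\<^sub>m n" using scalar_iff_mem_center[OF g] by blast
  then have "c = 1" using eq degree_pos character_scalar[OF g c] by simp
  then show "\<rho> g = 1\<^sub>m n" using c by auto
next
  assume "\<rho> g = 1\<^sub>m n"
  then show "g \<in> char_kernel G \<chi>"
    using g by (simp add: char_kernel_def character_one character_eq)
qed

lemma center_nonzero: "g \<in> char_center G \<chi> \<Longrightarrow> \<chi> g \<noteq> 0"
  using degree_pos by (auto simp: char_center_def character_one)

lemma subgroup_kernel: "subgroup (char_kernel G \<chi>) G"
proof (rule subgroupI)
  show "char_kernel G \<chi> \<subseteq> carrier G" by (auto simp: char_kernel_def)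
  show "char_kernel G \<chi> \<noteq> {}" by (auto simp: char_kernel_def)
next
  fix g assume g: "g \<in> char_kernel G \<chi>"
  then have gc: "g \<in> carrier G" by (simp add: char_kernel_def)
  have "\<rho> (inv g) = \<rho> (inv g) * \<rho> g"
    using g gc mem_kernel_iff[OF gc] right_mult_one_mat[OF rep_closed[of "inv g"]] by simp
  also have "\<dots> = 1\<^sub>m n" using gc by (simp add: rep_one flip: rep_mult)
  finally show "inv g \<in> char_kernel G \<chi>" using gc by (simp add: mem_kernel_iff)
next
  fix g h assume "g \<in> char_kernel G \<chi>" "h \<in> char_kernel G \<chi>"
  moreover from this have "g \<in> carrier G" "h \<in> carrier G" by (auto simp: char_kernel_def)
  ultimately show "g \<otimes> h \<in> char_kernel G \<chi>" by (simp add: mem_kernel_iff rep_mult)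
qed

text \<open>The identity \<open>h k = k h [h, k]\<close> transports commutation of the matrices to triviality of the
  matrix of the commutator and back.\<close>

lemma commutator_kernel_iff:
  assumes h: "h \<in> carrier G" and k: "k \<in> carrier G"
  shows "inv h \<otimes> inv k \<otimes> h \<otimes> k \<in> char_kernel G \<chi> \<longleftrightarrow> \<rho> h * \<rho> k = \<rho> k * \<rho> h"
proof -
  let ?c = "inv h \<otimes> inv k \<otimes> h \<otimes> k"
  have c: "?c \<in> carrier G" using assms by simp
  have hk: "h \<otimes> k = k \<otimes> h \<otimes> ?c"
  proof -
    have "k \<otimes> h \<otimes> ?c = k \<otimes> (h \<otimes> inv h) \<otimes> inv k \<otimes> h \<otimes> k"
      using assms by (simp only: m_assoc inv_closed m_closed)
    then show ?thesis using assms by simp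
  qed
  then have eq: "\<rho> h * \<rho> k = \<rho> k * \<rho> h * \<rho> ?c"
    using assms c by (metis m_closed rep_mult)
  show ?thesis
  proof
    assume "?c \<in> char_kernel G \<chi>"
    then show "\<rho> h * \<rho> k = \<rho> k * \<rho> h"
      using eq assms mem_kernel_iff[OF c]
        right_mult_one_mat[OF mult_carrier_mat[OF rep_closed[OF k] rep_closed[OF h]]] by simp
  next
    assume comm: "\<rho> h * \<rho> k = \<rho> k * \<rho> h"
    have "?c = inv (k \<otimes> h) \<otimes> (h \<otimes> k)" using assms by (simp add: inv_mult_group m_assoc)
    then have "\<rho> ?c = \<rho> (inv (k \<otimes> h)) * \<rho> (h \<otimes> k)" using assms by (simp add: rep_mult)
    also have "\<rho> (h \<otimes> k) = \<rho> (k \<otimes> h)" using assms comm by (simp add: rep_mult)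
    also have "\<rho> (inv (k \<otimes> h)) * \<rho> (k \<otimes> h) = 1\<^sub>m n"
      using assms by (simp add: rep_one flip: rep_mult)
    finally show "?c \<in> char_kernel G \<chi>" using mem_kernel_iff[OF c] by simp
  qed
qed

text \<open>The bridge between the chain \<open>\<epsilon>\<close>, which is defined through kernels of characters, and the
  centers: Schur's lemma gives one direction, and centrality of scalar matrices the other.\<close>

lemma commutator_subgroup_kernel_iff:
  assumes X: "X \<subseteq> carrier G"
  shows "commutator_subgroup G X (carrier G) \<subseteq> char_kernel G \<chi> \<longleftrightarrow> X \<subseteq> char_center G \<chi>"
proof
  assume sub: "commutator_subgroup G X (carrier G) \<subseteq> char_kernel G \<chi>"
  show "X \<subseteq> char_center G \<chi>"
  proof
    fix h assume h: "h \<in> X"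
    then have hc: "h \<in> carrier G" using X by blast
    have "\<rho> h * \<rho> k = \<rho> k * \<rho> h" if "k \<in> carrier G" for k
    proof -
      have "inv h \<otimes> inv k \<otimes> h \<otimes> k \<in> commutator_subgroup G X (carrier G)"
        unfolding commutator_subgroup_def using h that by (intro generate.incl) blast
      then show ?thesis using sub commutator_kernel_iff[OF hc that] by blast
    qed
    then show "h \<in> char_center G \<chi>"
      using schur[OF rep_closed[OF hc]] scalar_iff_mem_center[OF hc] by blast
  qed
next
  assume sub: "X \<subseteq> char_center G \<chi>"
  show "commutator_subgroup G X (carrier G) \<subseteq> char_kernel G \<chi>"
    unfolding commutator_subgroup_def
  proof (rule generate_subgroup_incl[OF _ subgroup_kernel], safe)
    fix h k assume h: "h \<in> X" and k: "k \<in> carrier G"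
    then have hc: "h \<in> carrier G" using X by blast
    obtain c where "\<rho> h = c \<cdot>\<^sub>m 1\<^sub>m n" using h sub scalar_iff_mem_center[OF hc] by blast
    then have "\<rho> h * \<rho> k = \<rho> k * \<rho> h"
      using rep_closed[OF k] by (simp add: mult_smult_distrib[of _ n n _ n] mult_smult_assoc_mat[of _ n n _ n])
    then show "inv h \<otimes> inv k \<otimes> h \<otimes> k \<in> char_kernel G \<chi>"
      using commutator_kernel_iff[OF hc k] by blast
  qed
qed

text \<open>The sum \<open>S\<close> of all matrices of the representation has trace \<open>\<chi>(1) \<noteq> 0\<close>, hence a nonzero
  column, and its columns are fixed by the group.  By irreducibility every vector is fixed, so
  \<open>\<chi>\<close> is constant with a nonzero value and cannot vanish anywhere.\<close>

lemma trivial_if_vanishes_off_one: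
  assumes van: "\<And>g. g \<in> carrier G \<Longrightarrow> g \<noteq> \<one> \<Longrightarrow> \<chi> g = 0"
  shows "carrier G = {\<one>}"
proof -
  define S where "S = mat n n (\<lambda>ij. \<Sum>g\<in>carrier G. \<rho> g $$ ij)"
  have S: "S \<in> carrier_mat n n" by (simp add: S_def)
  have left: "\<rho> h * S = S" if h: "h \<in> carrier G" for h
  proof (rule eq_matI)
    fix i j assume "i < dim_row S" "j < dim_col S"
    then have ij: "i < n" "j < n" using S by auto
    have "(\<rho> h * S) $$ (i, j) = (\<Sum>l<n. \<Sum>g\<in>carrier G. \<rho> h $$ (i, l) * \<rho> g $$ (l, j))"
      using ij rep_closed[OF h]
      by (auto simp: scalar_prod_def S_def atLeast0LessThan sum_distrib_left intro!: sum.cong)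
    also have "\<dots> = (\<Sum>g\<in>carrier G. \<Sum>l<n. \<rho> h $$ (i, l) * \<rho> g $$ (l, j))"
      by (rule sum.swap)
    also have "\<dots> = (\<Sum>g\<in>carrier G. \<rho> (h \<otimes> g) $$ (i, j))"
    proof (rule sum.cong)
      fix g assume g: "g \<in> carrier G"
      show "(\<Sum>l<n. \<rho> h $$ (i, l) * \<rho> g $$ (l, j)) = \<rho> (h \<otimes> g) $$ (i, j)"
        using ij rep_closed[OF h] rep_closed[OF g]
        by (auto simp: rep_mult[OF h g] scalar_prod_def atLeast0LessThan intro!: sum.cong)
    qed simp
    \<comment> \<open>left translation by \<open>h\<close> permutes the group\<close>
    also have "\<dots> = (\<Sum>g\<in>carrier G. \<rho> g $$ (i, j))"
      by (rule sum.reindex_bij_witness[where i = "\<lambda>g. inv h \<otimes> g" and j = "\<lambda>g. h \<otimes> g"])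
        (use h in \<open>auto simp: m_assoc[symmetric]\<close>)
    finally show "(\<rho> h * S) $$ (i, j) = S $$ (i, j)" using ij by (simp add: S_def)
  qed (use S rep_closed[OF h] in auto)
  define W where "W = {w \<in> carrier_vec n. \<forall>h\<in>carrier G. \<rho> h *\<^sub>v w = w}"
  have "W = {0\<^sub>v n} \<or> W = carrier_vec n"
  proof (rule invariant_subspace_trivial)
    fix v w assume "v \<in> W" "w \<in> W"
    then show "v + w \<in> W"
      by (auto simp: W_def mult_add_distrib_mat_vec[OF rep_closed])
  next
    fix c v assume "v \<in> W"
    then show "c \<cdot>\<^sub>v v \<in> W" by (auto simp: W_def mult_mat_vec[OF rep_closed])
  next
    show "0\<^sub>v n \<in> W"
    proof -
      have "\<rho> h *\<^sub>v 0\<^sub>v n = 0\<^sub>v n" if "h \<in> carrier G" for h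
        using rep_closed[OF that] by (intro eq_vecI) auto
      then show ?thesis by (simp add: W_def)
    qed
  qed (auto simp: W_def)
  moreover have cols: "col S j \<in> W" if "j < n" for j
  proof -
    have "\<rho> h *\<^sub>v col S j = col S j" if "h \<in> carrier G" for h
      using col_mult2[OF rep_closed[OF that] S \<open>j < n\<close>] left[OF that] by simp
    then show ?thesis using S that by (auto simp: W_def)
  qed
  moreover have "\<exists>j<n. col S j \<noteq> 0\<^sub>v n"
  proof (rule ccontr)
    assume "\<not> ?thesis"
    then have zero: "S $$ (j, j) = 0" if "j < n" for j
      using that S by (metis carrier_matD index_col index_zero_vec(1))
    have "of_nat n = (\<Sum>g\<in>carrier G. if g = \<one> then \<chi> g else 0)"
      using finite_carrier by (simp add: character_one)
    also have "\<dots> = (\<Sum>g\<in>carrier G. \<chi> g)" by (rule sum.cong) (auto simp: van)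
    also have "\<dots> = (\<Sum>g\<in>carrier G. \<Sum>i<n. \<rho> g $$ (i, i))" by (simp add: character_eq)
    also have "\<dots> = (\<Sum>i<n. S $$ (i, i))" by (subst sum.swap) (simp add: S_def)
    finally show False using zero degree_pos by simp
  qed
  ultimately have W: "W = carrier_vec n" by auto
  have "g = \<one>" if g: "g \<in> carrier G" for g
  proof (rule ccontr)
    assume "g \<noteq> \<one>"
    then have "\<chi> g = 0" using van g by blast
    moreover have "\<rho> g = 1\<^sub>m n"
      using g W by (intro mat_eq_if_eq_on_vecs[OF rep_closed]) (auto simp: W_def)
    ultimately show False using degree_pos by (simp add: character_eq[OF g])
  qed
  then show ?thesis by auto
qed

end

section \<open>The chain of vanishing-off subgroups\<close>

context group
begin

lemma Irr_cases:
  assumes "finite (carrier G)" and "\<chi> \<in> Irr G"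
  obtains n \<rho> where "finite_irrep G n \<rho>" and "\<chi> = rep_character G n \<rho>"
  using assms that by (auto simp: Irr_def intro: finite_irrep.intro finite_irrep_axioms.intro is_group)

lemma Irr_over_commutator_iff:
  assumes fin: "finite (carrier G)" and \<chi>: "\<chi> \<in> Irr G" and X: "X \<subseteq> carrier G"
  shows "\<chi> \<in> Irr_over G (commutator_subgroup G X (carrier G)) \<longleftrightarrow> \<not> X \<subseteq> char_center G \<chi>"
  using fin \<chi>
proof (cases rule: Irr_cases)
  case (1 n \<rho>)
  then interpret finite_irrep G n \<rho> by blast
  show ?thesis using \<chi> commutator_subgroup_kernel_iff[OF X] 1(2) by (simp add: Irr_over_def)
qed

lemma nonzero_on_char_center:
  assumes "finite (carrier G)" and "\<chi> \<in> Irr G" and "g \<in> char_center G \<chi>"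
  shows "\<chi> g \<noteq> 0"
  using assms(1,2)
proof (cases rule: Irr_cases)
  case (1 n \<rho>)
  then show ?thesis using finite_irrep.center_nonzero[OF 1(1)] assms(3) by simp
qed

lemma one_mem_char_center:
  assumes "finite (carrier G)" and "\<chi> \<in> Irr G"
  shows "\<one> \<in> char_center G \<chi>"
  using assms
proof (cases rule: Irr_cases)
  case (1 n \<rho>)
  then show ?thesis using finite_irrep.character_one[OF 1(1)] by (simp add: char_center_def)
qed

lemma char_center_subset: "char_center G \<chi> \<subseteq> carrier G"
  by (auto simp: char_center_def)

lemma eps_subgroup: "subgroup (eps G i) G"
proof -
  consider "i = 0 \<or> i = 1" | j where "i = Suc (Suc j)"
    by (metis One_nat_def not0_implies_Suc)
  then show ?thesis
  proof cases
    case 1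
    then show ?thesis using subgroup_self by auto
  next
    case 2
    then show ?thesis by (auto simp: V_over_def intro!: generate_is_subgroup)
  qed
qed

text \<open>Both groups are the first member of the chain that is contained in \<open>Z(\<chi>)\<close>: this
  member is either \<open>G\<close> or a vanishing-off subgroup that contains the support of \<open>\<chi>\<close>, and \<open>\<chi>\<close> does not vanish on its center.\<close>

lemma char_center_eq_eps_if_eps_trivial:
  assumes fin: "finite (carrier G)" and trivial: "eps G m = {\<one>}" and \<chi>: "\<chi> \<in> Irr G"
  obtains i where "char_center G \<chi> = eps G i" and "char_V G \<chi> = eps G i"
proof -
  let ?Z = "char_center G \<chi>"
  \<comment> \<open>The index is shifted because the chain starts at \<open>1\<close>.\<close>
  define i where "i = (LEAST i. eps G (Suc i) \<subseteq> ?Z)"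
  have "eps G (Suc m) \<subseteq> ?Z"
    using eps_Suc_subset[of m] one_mem_char_center[OF fin \<chi>] unfolding trivial by blast
  then have below: "eps G (Suc i) \<subseteq> ?Z" unfolding i_def by (rule LeastI)
  have support: "{g \<in> carrier G. \<chi> g \<noteq> 0} \<subseteq> eps G (Suc i)"
  proof (cases i)
    case 0
    then show ?thesis by auto
  next
    case (Suc j)
    have "\<not> eps G (Suc j) \<subseteq> ?Z" using not_less_Least[of j "\<lambda>i. eps G (Suc i) \<subseteq> ?Z"] Suc by (simp add: i_def)
    then have "\<chi> \<in> Irr_over G (commutator_subgroup G (eps G (Suc j)) (carrier G))"
      using Irr_over_commutator_iff[OF fin \<chi>] subgroup.subset[OF eps_subgroup] by blast
    then show ?thesis
      unfolding Suc eps.simps V_over_def by (auto intro: generate.incl)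
  qed
  moreover have "?Z \<subseteq> {g \<in> carrier G. \<chi> g \<noteq> 0}"
    using nonzero_on_char_center[OF fin \<chi>] char_center_subset by blast
  ultimately have "?Z = eps G (Suc i)" and "{g \<in> carrier G. \<chi> g \<noteq> 0} = eps G (Suc i)"
    using below by blast+
  moreover have "generate G (eps G (Suc i)) = eps G (Suc i)"
    using eps_subgroup generateI[OF eps_subgroup] by (metis subset_refl)
  ultimately show thesis using that[of "Suc i"] by (simp add: char_V_def)
qed

lemma nested_GVZ_if_eps_trivial:
  assumes fin: "finite (carrier G)" and trivial: "eps G m = {\<one>}"
  shows "nested_group G" and "GVZ_group G"
proof -
  have mono: "eps G j \<subseteq> eps G i" if "i \<le> j" for i j
    using that by (rule lift_Suc_antimono_le[of "eps G", OF eps_Suc_subset])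
  show "nested_group G"
    unfolding nested_group_def chain_subset_def
  proof safe
    fix \<chi> \<psi> x y
    assume \<chi>: "\<chi> \<in> Irr G" and \<psi>: "\<psi> \<in> Irr G"
      and x: "x \<in> char_center G \<psi>" "x \<notin> char_center G \<chi>" and y: "y \<in> char_center G \<chi>"
    obtain i where i: "char_center G \<chi> = eps G i"
      by (rule char_center_eq_eps_if_eps_trivial[OF fin trivial \<chi>])
    obtain j where j: "char_center G \<psi> = eps G j"
      by (rule char_center_eq_eps_if_eps_trivial[OF fin trivial \<psi>])
    show "y \<in> char_center G \<psi>"
      using mono[of i j] mono[of j i] x y unfolding i j by (cases "i \<le> j") auto
  qed
  show "GVZ_group G"
    unfolding GVZ_group_def
  proof
    fix \<chi> assume "\<chi> \<in> Irr G"
    then show "char_V G \<chi> = char_center G \<chi>"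
      by (rule char_center_eq_eps_if_eps_trivial[OF fin trivial]) simp
  qed
qed

lemma support_GVZ:
  assumes fin: "finite (carrier G)" and "GVZ_group G" and \<chi>: "\<chi> \<in> Irr G"
  shows "{g \<in> carrier G. \<chi> g \<noteq> 0} = char_center G \<chi>"
proof
  show "{g \<in> carrier G. \<chi> g \<noteq> 0} \<subseteq> char_center G \<chi>"
    using assms(2) \<chi> by (auto simp: GVZ_group_def char_V_def intro: generate.incl)
  show "char_center G \<chi> \<subseteq> {g \<in> carrier G. \<chi> g \<noteq> 0}"
    using nonzero_on_char_center[OF fin \<chi>] char_center_subset by blast
qed

lemma char_center_ne_one:
  assumes fin: "finite (carrier G)" and GVZ: "GVZ_group G" and \<chi>: "\<chi> \<in> Irr G"
    and nontrivial: "carrier G \<noteq> {\<one>}"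
  shows "char_center G \<chi> \<noteq> {\<one>}"
proof
  assume Z: "char_center G \<chi> = {\<one>}"
  show False
    using fin \<chi>
  proof (cases rule: Irr_cases)
    case (1 n \<rho>)
    then show False
      using finite_irrep.trivial_if_vanishes_off_one[OF 1(1)] support_GVZ[OF fin GVZ \<chi>] Z nontrivial
      by blast
  qed
qed

lemma V_over_commutator_GVZ:
  assumes fin: "finite (carrier G)" and GVZ: "GVZ_group G" and X: "X \<subseteq> carrier G"
  shows "V_over G (commutator_subgroup G X (carrier G)) =
         generate G (\<Union>{Z \<in> char_center G ` Irr G. \<not> X \<subseteq> Z})"
proof -
  have "{g \<in> carrier G. \<exists>\<chi>\<in>Irr_over G (commutator_subgroup G X (carrier G)). \<chi> g \<noteq> 0} =
        (\<Union>\<chi>\<in>{\<chi> \<in> Irr G. \<not> X \<subseteq> char_center G \<chi>}. {g \<in> carrier G. \<chi> g \<noteq> 0})"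
  proof -
    have "Irr_over G (commutator_subgroup G X (carrier G)) = {\<chi> \<in> Irr G. \<not> X \<subseteq> char_center G \<chi>}"
      using Irr_over_commutator_iff[OF fin _ X] by (auto simp only: Irr_over_def)
    then show ?thesis by auto
  qed
  also have "\<dots> = (\<Union>\<chi>\<in>{\<chi> \<in> Irr G. \<not> X \<subseteq> char_center G \<chi>}. char_center G \<chi>)"
    using support_GVZ[OF fin GVZ] by (intro SUP_cong) auto
  also have "\<dots> = \<Union>{Z \<in> char_center G ` Irr G. \<not> X \<subseteq> Z}" by auto
  finally show ?thesis unfolding V_over_def by (rule arg_cong)
qed

text \<open>One step of the recursion goes from a center to the next smaller one.  Since the centers form a
  chain, those not containing \<open>X\<close> are the ones properly inside \<open>X\<close>, and the union of a
  nonempty finite chain is its largest member.  Besides the centers, \<open>X\<close> may be \<open>G\<close>,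
  where the recursion starts.\<close>

lemma V_over_commutator_nested_GVZ:
  assumes fin: "finite (carrier G)" and nested: "nested_group G" and GVZ: "GVZ_group G"
    and X: "X \<in> insert (carrier G) (char_center G ` Irr G)"
  obtains
    (bottom) "\<forall>Z\<in>char_center G ` Irr G. X \<subseteq> Z"
      "V_over G (commutator_subgroup G X (carrier G)) = {\<one>}"
  | (next_center) "V_over G (commutator_subgroup G X (carrier G)) \<in> char_center G ` Irr G"
      "V_over G (commutator_subgroup G X (carrier G)) \<subset> X"
      "\<forall>Z\<in>char_center G ` Irr G. Z \<subset> X \<longrightarrow> Z \<subseteq> V_over G (commutator_subgroup G X (carrier G))"
proof -
  let ?S = "char_center G ` Irr G"
  define C where "C = {Z \<in> ?S. \<not> X \<subseteq> Z}"
  have Xc: "X \<subseteq> carrier G" using X char_center_subset by blast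
  have V: "V_over G (commutator_subgroup G X (carrier G)) = generate G (\<Union>C)"
    unfolding C_def by (rule V_over_commutator_GVZ[OF fin GVZ Xc])
  have C: "C = {Z \<in> ?S. Z \<subset> X}"
    using X nested char_center_subset unfolding C_def nested_group_def chain_subset_def by blast
  show thesis
  proof (cases "C = {}")
    case True
    have "\<forall>Z\<in>?S. X \<subseteq> Z" using True unfolding C_def by blast
    moreover have "generate G (\<Union>C) = {\<one>}" unfolding True by (simp add: generate_empty)
    ultimately show thesis using bottom V by simp
  next
    case False
    have "finite C"
      by (rule finite_subset[of _ "Pow (carrier G)"]) (use fin char_center_subset in \<open>auto simp: C_def\<close>)
    moreover have "subset.chain C C"
      using nested by (auto simp: C_def nested_group_def chain_subset_def subset_chain_def)
    ultimately have M: "\<Union>C \<in> C" using False by (metis Union_in_chain)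
    then obtain \<chi> where \<chi>: "\<chi> \<in> Irr G" "\<Union>C = char_center G \<chi>" by (auto simp: C_def)
    have "generate G (\<Union>C) = \<Union>C"
      using GVZ \<chi> support_GVZ[OF fin GVZ \<chi>(1)] by (auto simp: GVZ_group_def char_V_def)
    then show thesis using next_center M V unfolding C by auto
  qed
qed

text \<open>For the converse direction, the stable member of the chain is trivial or \<open>G\<close> or a center, and
  in the last two cases the next member would be trivial or strictly smaller.\<close>

lemma eps_inf_trivial_iff:
  assumes fin: "finite (carrier G)"
  shows "eps_inf G = {\<one>} \<longleftrightarrow> nested_group G \<and> GVZ_group G"
proof -
  let ?S = "char_center G ` Irr G"
  obtain m where m: "\<And>i. m \<le> i \<Longrightarrow> eps G i = eps_inf G"
    using eventually_eps_eq_eps_inf[OF fin] unfolding eventually_sequentially by blast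
  show ?thesis
  proof
    assume "eps_inf G = {\<one>}"
    then have "eps G m = {\<one>}" using m[of m] by simp
    then show "nested_group G \<and> GVZ_group G" using nested_GVZ_if_eps_trivial[OF fin] by blast
  next
    assume "nested_group G \<and> GVZ_group G"
    then have nested: "nested_group G" and GVZ: "GVZ_group G" by auto
    note step = V_over_commutator_nested_GVZ[OF fin nested GVZ]
    have center: "eps G (Suc i) = {\<one>} \<or> eps G (Suc i) \<in> insert (carrier G) ?S" for i
    proof (induction i)
      case (Suc i)
      from Suc.IH show ?case
      proof
        assume "eps G (Suc i) = {\<one>}"
        then have "eps G (Suc (Suc i)) = {\<one>}"
          using eps_Suc_subset[of "Suc i"] subgroup.one_closed[OF eps_subgroup[of "Suc (Suc i)"]]
          by blast
        then show ?case ..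
      next
        assume "eps G (Suc i) \<in> insert (carrier G) ?S"
        then show ?case by (rule step) auto
      qed
    qed simp
    have fixed: "V_over G (commutator_subgroup G (eps G (Suc m)) (carrier G)) = eps G (Suc m)"
      using m[of "Suc m"] m[of "Suc (Suc m)"] by simp
    from center[of m] have "eps G (Suc m) = {\<one>}"
    proof
      assume "eps G (Suc m) \<in> insert (carrier G) ?S"
      then show ?thesis by (rule step) (use fixed in auto)
    qed
    then show "eps_inf G = {\<one>}" using m[of "Suc m"] by simp
  qed
qed

text \<open>The enumeration of the centers is strictly decreasing and exhaustive, so the largest center
  properly inside \<open>X i\<close> is \<open>X (Suc i)\<close>, and no center lies properly inside \<open>X n\<close>.\<close>

lemma eps_eq_chain_of_centers:
  assumes fin: "finite (carrier G)" and nested: "nested_group G" and GVZ: "GVZ_group G"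
    and chain: "chain_of_centers G n X"
  shows "i \<le> n \<Longrightarrow> eps G (Suc i) = X i" and "eps G (Suc (Suc n)) = {\<one>}"
proof -
  let ?S = "char_center G ` Irr G"
  note step = V_over_commutator_nested_GVZ[OF fin nested GVZ]
  have X0: "X 0 = carrier G" and strict: "\<And>i. i < n \<Longrightarrow> X (Suc i) \<subset> X i" and S: "?S = X ` {..n}"
    using chain by (auto simp: chain_of_centers_def)
  have antimono: "X j \<subseteq> X i" if "i \<le> j" "j \<le> n" for i j
    using that
  proof (induction j rule: dec_induct)
    case (step j)
    then show ?case using strict[of j] by auto
  qed simp
  have mem: "X i \<in> ?S" if "i \<le> n" for i using S that by auto
  have next_X: "V_over G (commutator_subgroup G (X i) (carrier G)) = X (Suc i)" (is "?V = _")
    if i: "i < n" for i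
  proof -
    have "X i \<in> insert (carrier G) ?S" using mem[of i] i by simp
    then show ?thesis
    proof (rule step)
      assume "\<forall>Z\<in>?S. X i \<subseteq> Z"
      then show ?thesis using mem[of "Suc i"] strict[OF i] i by auto
    next
      assume V: "?V \<in> ?S" "?V \<subset> X i" and max: "\<forall>Z\<in>?S. Z \<subset> X i \<longrightarrow> Z \<subseteq> ?V"
      obtain j where j: "j \<le> n" "?V = X j" using V(1) unfolding S by auto
      then have "\<not> j \<le> i" using antimono[of j i] V(2) i by auto
      then have "?V \<subseteq> X (Suc i)" using j antimono[of "Suc i" j] by simp
      moreover have "X (Suc i) \<subseteq> ?V" using max mem[of "Suc i"] strict[OF i] i by auto
      ultimately show ?thesis by blast
    qed
  qed
  show eq: "eps G (Suc i) = X i" if "i \<le> n" for i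
    using that
  proof (induction i)
    case (Suc i)
    then show ?case using next_X[of i] by simp
  qed (simp add: X0)
  have "X n \<in> insert (carrier G) ?S" using mem[of n] by simp
  then have "V_over G (commutator_subgroup G (X n) (carrier G)) = {\<one>}"
  proof (rule step)
    assume V: "V_over G (commutator_subgroup G (X n) (carrier G)) \<in> ?S"
      "V_over G (commutator_subgroup G (X n) (carrier G)) \<subset> X n"
    then show ?thesis using antimono[of _ n] unfolding S by auto
  qed
  then show "eps G (Suc (Suc n)) = {\<one>}" using eq[of n] by simp
qed

lemma comm_group_if_trivial:
  assumes "carrier G = {\<one>}"
  shows "comm_group G"
  by (rule group_comm_groupI) (use assms in auto)

end

theorem theorem4:
  fixes G (structure) and p :: nat
  assumes "group G" and "finite (carrier G)"
    and "prime p" and "\<exists>a. Coset.order G = p ^ a"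
    and "\<not> comm_group G"
  shows "(eps_inf G = {\<one>} \<longleftrightarrow> nested_group G \<and> GVZ_group G) \<and>
         (nested_group G \<and> GVZ_group G \<longrightarrow>
           (\<forall>n X. chain_of_centers G n X \<longrightarrow>
             {\<one>} \<subset> X n \<and> (\<forall>i\<le>n. eps G (i + 1) = X i) \<and> eps G (n + 2) = {\<one>}))"
proof -
  interpret group G by fact
  note fin = \<open>finite (carrier G)\<close>
  have "{\<one>} \<subset> X n \<and> (\<forall>i\<le>n. eps G (i + 1) = X i) \<and> eps G (n + 2) = {\<one>}"
    if nested: "nested_group G" and GVZ: "GVZ_group G" and chain: "chain_of_centers G n X" for n X
  proof -
    have "char_center G ` Irr G = X ` {..n}" using chain by (simp add: chain_of_centers_def)
    then have "X n \<in> char_center G ` Irr G" by simp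
    then obtain \<chi> where \<chi>: "\<chi> \<in> Irr G" "X n = char_center G \<chi>" by auto
    have "carrier G \<noteq> {\<one>}" using comm_group_if_trivial \<open>\<not> comm_group G\<close> by blast
    then have "{\<one>} \<subset> X n"
      using char_center_ne_one[OF fin GVZ \<chi>(1)] one_mem_char_center[OF fin \<chi>(1)] \<chi>(2) by auto
    then show ?thesis using eps_eq_chain_of_centers[OF fin nested GVZ chain] by simp
  qed
  then show ?thesis using eps_inf_trivial_iff[OF fin] by blast
qed

end
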